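(* Let $G:I\to I$ be the Gauss map and let $\alpha\in(0,1]$. There is a nonempty open subset of $C^{0,\alpha}(I)$ consisting of functions which do not have the periodic optimization property (with respect to $G$).
   Context: $I=[0,1]$; the Gauss map $G:I\to I$ is $G(x)=\frac1x-\lfloor\frac1x\rfloor$ for $x\in(0,1]$ and $G(0)=0$. $C^{0,\alpha}(I)$ is the Banach space of real-valued $\alpha$-Hölder functions with norm $\|\psi\|_\infty+\sup_{x\ne y}|\psi(x)-\psi(y)|/|x-y|^\alpha$. $\mathcal{M}(I,G)$ is the set of $G$-invariant Borel probability measures on $I$. A measure $\mu\in\mathcal{M}(I,G)$ is $(G,\phi)$-maximizing if $\int\phi\,d\mu=Q(G,\phi):=\sup_{\nu\in\mathcal{M}(I,G)}\int\phi\,d\nu$. A function $\phi\in C^{0,\alpha}(I)$ has the periodic optimization property if there exists a $G$-periodic orbit $\mathcal{O}$ such that the probability measure uniformly distributed on $\mathcal{O}$ is the unique $(G,\phi)$-maximizing measure. *)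

theory Defs
  imports "HOL-Probability.Probability"
begin

abbreviation unit_I :: "real set" where
  "unit_I \<equiv> {0..1}"

definition gauss :: "real \<Rightarrow> real" where
  "gauss x = (if x = 0 then 0 else 1 / x - of_int \<lfloor>1 / x\<rfloor>)"

lemma gauss_in_unit_I: "gauss x \<in> unit_I"
proof -
  have "0 \<le> 1 / x - of_int \<lfloor>1 / x\<rfloor>" "1 / x - of_int \<lfloor>1 / x\<rfloor> \<le> 1"
    by linarith+
  then show ?thesis by (simp add: gauss_def)
qed

lemma gauss_measurable_borel: "gauss \<in> borel_measurable borel"
  unfolding gauss_def by measurable

definition holder_fun :: "real \<Rightarrow> (real \<Rightarrow> real) \<Rightarrow> bool" where
  "holder_fun \<alpha> \<psi> \<longleftrightarrow> (\<exists>C. \<forall>x\<in>unit_I. \<forall>y\<in>unit_I. \<bar>\<psi> x - \<psi> y\<bar> \<le> C * \<bar>x - y\<bar> powr \<alpha>)"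

(* Functions on the unit interval are represented by functions on the reals that take the
   default value outside of it, so that equality of elements is equality on the interval. *)
definition holder_space :: "real \<Rightarrow> (real \<Rightarrow> real) set" where
  "holder_space \<alpha> = {\<psi> \<in> extensional unit_I. holder_fun \<alpha> \<psi>}"

definition holder_seminorm :: "real \<Rightarrow> (real \<Rightarrow> real) \<Rightarrow> real" where
  "holder_seminorm \<alpha> \<psi> =
     Sup {\<bar>\<psi> x - \<psi> y\<bar> / \<bar>x - y\<bar> powr \<alpha> | x y. x \<in> unit_I \<and> y \<in> unit_I \<and> x \<noteq> y}"

definition holder_norm :: "real \<Rightarrow> (real \<Rightarrow> real) \<Rightarrow> real" where
  "holder_norm \<alpha> \<psi> = (SUP x\<in>unit_I. \<bar>\<psi> x\<bar>) + holder_seminorm \<alpha> \<psi>"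

(* The norm only looks at values on the interval, so the pointwise difference need not be
   restricted to it. The value 0 outside the carrier is there because the metric space locale
   asks for nonnegativity and symmetry of the distance on the whole type. *)
definition holder_dist :: "real \<Rightarrow> (real \<Rightarrow> real) \<Rightarrow> (real \<Rightarrow> real) \<Rightarrow> real" where
  "holder_dist \<alpha> \<phi> \<psi> =
     (if \<phi> \<in> holder_space \<alpha> \<and> \<psi> \<in> holder_space \<alpha> then holder_norm \<alpha> (\<lambda>x. \<phi> x - \<psi> x) else 0)"

definition holder_topology :: "real \<Rightarrow> (real \<Rightarrow> real) topology" where
  "holder_topology \<alpha> = Metric_space.mtopology (holder_space \<alpha>) (holder_dist \<alpha>)"

lemma holder_fun_diff:
  assumes "holder_fun \<alpha> f" "holder_fun \<alpha> g"
  shows "holder_fun \<alpha> (\<lambda>x. f x - g x)"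
proof -
  obtain C D where
    C: "\<And>x y. x \<in> unit_I \<Longrightarrow> y \<in> unit_I \<Longrightarrow> \<bar>f x - f y\<bar> \<le> C * \<bar>x - y\<bar> powr \<alpha>" and
    D: "\<And>x y. x \<in> unit_I \<Longrightarrow> y \<in> unit_I \<Longrightarrow> \<bar>g x - g y\<bar> \<le> D * \<bar>x - y\<bar> powr \<alpha>"
    using assms unfolding holder_fun_def by metis
  have "\<bar>f x - g x - (f y - g y)\<bar> \<le> (C + D) * \<bar>x - y\<bar> powr \<alpha>"
    if "x \<in> unit_I" "y \<in> unit_I" for x y
    using C[OF that] D[OF that] by (simp add: distrib_right)
  then show ?thesis unfolding holder_fun_def by blast
qed

lemma holder_fun_bdd_quotients:
  assumes "holder_fun \<alpha> f"
  shows "bdd_above {\<bar>f x - f y\<bar> / \<bar>x - y\<bar> powr \<alpha> | x y. x \<in> unit_I \<and> y \<in> unit_I \<and> x \<noteq> y}"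
proof -
  obtain C where
    C: "\<And>x y. x \<in> unit_I \<Longrightarrow> y \<in> unit_I \<Longrightarrow> \<bar>f x - f y\<bar> \<le> C * \<bar>x - y\<bar> powr \<alpha>"
    using assms unfolding holder_fun_def by metis
  have "\<bar>f x - f y\<bar> / \<bar>x - y\<bar> powr \<alpha> \<le> C" if "x \<in> unit_I" "y \<in> unit_I" "x \<noteq> y" for x y
    using C[OF that(1,2)] that(3) by (simp add: divide_le_eq)
  then show ?thesis by (intro bdd_aboveI[of _ C]) blast
qed

lemma holder_fun_bdd_values:
  assumes "0 < \<alpha>" "holder_fun \<alpha> f"
  shows "bdd_above ((\<lambda>x. \<bar>f x\<bar>) ` unit_I)"
proof -
  obtain C where
    C: "\<And>x y. x \<in> unit_I \<Longrightarrow> y \<in> unit_I \<Longrightarrow> \<bar>f x - f y\<bar> \<le> C * \<bar>x - y\<bar> powr \<alpha>"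
    using assms unfolding holder_fun_def by metis
  have "\<bar>f x\<bar> \<le> \<bar>C\<bar> + \<bar>f 0\<bar>" if x: "x \<in> unit_I" for x
  proof -
    have "C * \<bar>x\<bar> powr \<alpha> \<le> \<bar>C\<bar> * 1"
      using x assms(1) by (intro mult_mono) (auto simp: powr_le1)
    then show ?thesis using C[OF x, of 0] by auto
  qed
  then show ?thesis by (intro bdd_aboveI2) blast
qed

lemma holder_seminorm_upper:
  assumes "holder_fun \<alpha> f" "x \<in> unit_I" "y \<in> unit_I" "x \<noteq> y"
  shows "\<bar>f x - f y\<bar> / \<bar>x - y\<bar> powr \<alpha> \<le> holder_seminorm \<alpha> f"
  unfolding holder_seminorm_def
  using assms by (intro cSup_upper holder_fun_bdd_quotients) auto

lemma holder_seminorm_least: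
  assumes "\<And>x y. x \<in> unit_I \<Longrightarrow> y \<in> unit_I \<Longrightarrow> x \<noteq> y \<Longrightarrow> \<bar>f x - f y\<bar> / \<bar>x - y\<bar> powr \<alpha> \<le> B"
  shows "holder_seminorm \<alpha> f \<le> B"
  unfolding holder_seminorm_def
proof (rule cSup_least)
  have "(0::real) \<in> unit_I \<and> (1::real) \<in> unit_I \<and> (0::real) \<noteq> 1" by simp
  then show "{\<bar>f x - f y\<bar> / \<bar>x - y\<bar> powr \<alpha> | x y. x \<in> unit_I \<and> y \<in> unit_I \<and> x \<noteq> y} \<noteq> {}"
    by blast
qed (use assms in blast)

lemma holder_seminorm_nonneg:
  assumes "holder_fun \<alpha> f"
  shows "0 \<le> holder_seminorm \<alpha> f"
  using holder_seminorm_upper[OF assms, of 0 1] by (simp add: order_trans[rotated])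

lemma Metric_space_holder:
  assumes \<alpha>: "0 < \<alpha>"
  shows "Metric_space (holder_space \<alpha>) (holder_dist \<alpha>)"
proof -
  have H: "holder_fun \<alpha> f" if "f \<in> holder_space \<alpha>" for f
    using that by (simp add: holder_space_def holder_fun_def)
  have val: "\<bar>f x\<bar> \<le> (SUP x\<in>unit_I. \<bar>f x\<bar>)" if "holder_fun \<alpha> f" "x \<in> unit_I" for f x
    using that by (intro cSUP_upper holder_fun_bdd_values[OF \<alpha>])
  have sup0: "0 \<le> (SUP x\<in>unit_I. \<bar>f x\<bar>)" if "holder_fun \<alpha> f" for f
    using val[OF that, of 0] by simp
  show ?thesis
  proof
    fix f g
    have "holder_norm \<alpha> (\<lambda>x. f x - g x) = holder_norm \<alpha> (\<lambda>x. g x - f x)"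
    proof -
      have "\<bar>f x - g x - (f y - g y)\<bar> = \<bar>g x - f x - (g y - f y)\<bar>" for x y
        by linarith
      then show ?thesis
        by (simp add: holder_norm_def holder_seminorm_def abs_minus_commute)
    qed
    then show "holder_dist \<alpha> f g = holder_dist \<alpha> g f"
      by (simp add: holder_dist_def)
    show "0 \<le> holder_dist \<alpha> f g"
    proof (cases "f \<in> holder_space \<alpha> \<and> g \<in> holder_space \<alpha>")
      case True
      then have "holder_fun \<alpha> (\<lambda>x. f x - g x)" using H holder_fun_diff by blast
      with True show ?thesis
        using sup0 holder_seminorm_nonneg
        by (simp add: holder_dist_def holder_norm_def)
    qed (auto simp: holder_dist_def)
  next
    fix f g assume fg: "f \<in> holder_space \<alpha>" "g \<in> holder_space \<alpha>"
    let ?h = "\<lambda>x. f x - g x"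
    have h: "holder_fun \<alpha> ?h" using fg H holder_fun_diff by blast
    show "holder_dist \<alpha> f g = 0 \<longleftrightarrow> f = g"
    proof
      assume "holder_dist \<alpha> f g = 0"
      then have "(SUP x\<in>unit_I. \<bar>?h x\<bar>) = 0"
        using sup0[OF h] holder_seminorm_nonneg[OF h] fg
        by (simp add: holder_dist_def holder_norm_def)
      then have "f x = g x" if "x \<in> unit_I" for x
        using val[OF h that] by simp
      then show "f = g"
        using fg by (auto simp: holder_space_def intro: extensionalityI)
    next
      assume "f = g"
      have "holder_seminorm \<alpha> (\<lambda>x. 0) \<le> 0" by (rule holder_seminorm_least) simp
      moreover have "0 \<le> holder_seminorm \<alpha> (\<lambda>x. 0)"
        using h \<open>f = g\<close> by (intro holder_seminorm_nonneg) simp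
      ultimately show "holder_dist \<alpha> f g = 0"
        using \<open>f = g\<close> by (simp add: holder_dist_def holder_norm_def)
    qed
  next
    fix f g k assume fgk: "f \<in> holder_space \<alpha>" "g \<in> holder_space \<alpha>" "k \<in> holder_space \<alpha>"
    let ?u = "\<lambda>x. f x - g x" and ?v = "\<lambda>x. g x - k x" and ?w = "\<lambda>x. f x - k x"
    have u: "holder_fun \<alpha> ?u" and v: "holder_fun \<alpha> ?v"
      using fgk H holder_fun_diff by blast+
    have "(SUP x\<in>unit_I. \<bar>?w x\<bar>) \<le> (SUP x\<in>unit_I. \<bar>?u x\<bar>) + (SUP x\<in>unit_I. \<bar>?v x\<bar>)"
    proof (rule cSUP_least)
      fix x :: real assume "x \<in> unit_I"
      from val[OF u this] val[OF v this]
      show "\<bar>?w x\<bar> \<le> (SUP x\<in>unit_I. \<bar>?u x\<bar>) + (SUP x\<in>unit_I. \<bar>?v x\<bar>)" by linarith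
    qed simp
    moreover have "holder_seminorm \<alpha> ?w \<le> holder_seminorm \<alpha> ?u + holder_seminorm \<alpha> ?v"
    proof (rule holder_seminorm_least)
      fix x y :: real assume xy: "x \<in> unit_I" "y \<in> unit_I" "x \<noteq> y"
      have "\<bar>?w x - ?w y\<bar> / \<bar>x - y\<bar> powr \<alpha>
          \<le> (\<bar>?u x - ?u y\<bar> + \<bar>?v x - ?v y\<bar>) / \<bar>x - y\<bar> powr \<alpha>"
        by (intro divide_right_mono) auto
      also have "\<dots> \<le> holder_seminorm \<alpha> ?u + holder_seminorm \<alpha> ?v"
        using holder_seminorm_upper[OF u xy] holder_seminorm_upper[OF v xy]
        by (simp add: add_divide_distrib)
      finally show "\<bar>?w x - ?w y\<bar> / \<bar>x - y\<bar> powr \<alpha>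
          \<le> holder_seminorm \<alpha> ?u + holder_seminorm \<alpha> ?v" .
    qed
    ultimately show "holder_dist \<alpha> f k \<le> holder_dist \<alpha> f g + holder_dist \<alpha> g k"
      using fgk by (simp add: holder_dist_def holder_norm_def)
  qed
qed

lemma topspace_holder_topology:
  assumes "0 < \<alpha>"
  shows "topspace (holder_topology \<alpha>) = holder_space \<alpha>"
  using Metric_space.topspace_mtopology[OF Metric_space_holder[OF assms]]
  by (simp add: holder_topology_def)

lemma openin_holder_topology:
  assumes "0 < \<alpha>"
  shows "openin (holder_topology \<alpha>) U \<longleftrightarrow>
    U \<subseteq> holder_space \<alpha> \<and>
    (\<forall>\<phi>\<in>U. \<exists>r>0. \<forall>\<psi>\<in>holder_space \<alpha>. holder_norm \<alpha> (\<lambda>x. \<phi> x - \<psi> x) < r \<longrightarrow> \<psi> \<in> U)"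
proof -
  interpret Metric_space "holder_space \<alpha>" "holder_dist \<alpha>"
    using assms by (rule Metric_space_holder)
  have "mball \<phi> r \<subseteq> U \<longleftrightarrow> (\<forall>\<psi>\<in>holder_space \<alpha>. holder_norm \<alpha> (\<lambda>x. \<phi> x - \<psi> x) < r \<longrightarrow> \<psi> \<in> U)"
    if "\<phi> \<in> holder_space \<alpha>" for \<phi> r
    using that by (auto simp: mball_def holder_dist_def)
  then show ?thesis
    unfolding holder_topology_def openin_mtopology by (auto simp: subset_iff)
qed


definition invariant_measures :: "(real \<Rightarrow> real) \<Rightarrow> real measure set" where
  "invariant_measures T = {\<mu>. sets \<mu> = sets (restrict_space borel unit_I) \<and> prob_space \<mu> \<and>
     T \<in> measurable \<mu> \<mu> \<and> distr \<mu> \<mu> T = \<mu>}"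

definition max_integral :: "(real \<Rightarrow> real) \<Rightarrow> (real \<Rightarrow> real) \<Rightarrow> real" where
  "max_integral T \<phi> = (SUP \<nu>\<in>invariant_measures T. integral\<^sup>L \<nu> \<phi>)"

definition maximizing_measure ::
    "(real \<Rightarrow> real) \<Rightarrow> (real \<Rightarrow> real) \<Rightarrow> real measure \<Rightarrow> bool" where
  "maximizing_measure T \<phi> \<mu> \<longleftrightarrow>
     \<mu> \<in> invariant_measures T \<and> integral\<^sup>L \<mu> \<phi> = max_integral T \<phi>"

definition periodic_orbit :: "(real \<Rightarrow> real) \<Rightarrow> real set \<Rightarrow> bool" where
  "periodic_orbit T S \<longleftrightarrow>
     (\<exists>p\<in>unit_I. \<exists>n>0. (T ^^ n) p = p \<and> S = {(T ^^ k) p | k. k < n})"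

definition orbit_measure :: "real set \<Rightarrow> real measure" where
  "orbit_measure S = distr (uniform_count_measure S) (restrict_space borel unit_I) (\<lambda>x. x)"

definition periodic_optimization_property :: "(real \<Rightarrow> real) \<Rightarrow> (real \<Rightarrow> real) \<Rightarrow> bool" where
  "periodic_optimization_property T \<phi> \<longleftrightarrow>
     (\<exists>S. periodic_orbit T S \<and> maximizing_measure T \<phi> (orbit_measure S) \<and>
       (\<forall>\<mu>. maximizing_measure T \<phi> \<mu> \<longrightarrow> \<mu> = orbit_measure S))"

(* For the Gauss map the measurability clause in the definition of invariant measures is
   automatic, so it excludes no measure. *)
lemma gauss_measurable:
  assumes "sets \<mu> = sets (restrict_space borel unit_I)"
  shows "gauss \<in> measurable \<mu> \<mu>"
proof -
  have "gauss \<in> measurable (restrict_space borel unit_I) (restrict_space borel unit_I)"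
    using gauss_in_unit_I gauss_measurable_borel
    by (intro measurable_restrict_space2 measurable_restrict_space1) auto
  then show ?thesis
    using measurable_cong_sets[OF assms assms] by simp
qed

lemma holder_fun_continuous_on:
  assumes "0 < \<alpha>" "holder_fun \<alpha> f"
  shows "continuous_on unit_I f"
proof -
  obtain C where
    C: "\<And>x y. x \<in> unit_I \<Longrightarrow> y \<in> unit_I \<Longrightarrow> \<bar>f x - f y\<bar> \<le> C * \<bar>x - y\<bar> powr \<alpha>"
    using assms unfolding holder_fun_def by metis
  have "(f \<longlongrightarrow> f y) (at y within unit_I)" if y: "y \<in> unit_I" for y
  proof (rule LIM_zero_cancel, rule Lim_null_comparison)
    show "\<forall>\<^sub>F x in at y within unit_I. norm (f x - f y) \<le> C * \<bar>x - y\<bar> powr \<alpha>"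
      using C y by (simp add: eventually_at_filter)
    have "((\<lambda>x. \<bar>x - y\<bar> powr \<alpha>) \<longlongrightarrow> 0) (at y within unit_I)"
      by (rule tendsto_zero_powrI[where b = \<alpha>]) (use assms(1) in \<open>auto intro!: tendsto_eq_intros\<close>)
    then show "((\<lambda>x. C * \<bar>x - y\<bar> powr \<alpha>) \<longlongrightarrow> 0) (at y within unit_I)"
      by (rule tendsto_mult_right_zero)
  qed
  then show ?thesis by (simp add: continuous_on_def)
qed

(* Hence no integral in the definition of the maximal integral takes the default value 0 of
   the Bochner integral, and the set under the supremum is bounded above. *)
lemma holder_fun_integrable:
  assumes "0 < \<alpha>" "holder_fun \<alpha> f" "\<mu> \<in> invariant_measures T"
  shows "integrable \<mu> f"
    and "\<bar>integral\<^sup>L \<mu> f\<bar> \<le> (SUP x\<in>unit_I. \<bar>f x\<bar>)"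
proof -
  interpret prob_space \<mu> using assms(3) by (simp add: invariant_measures_def)
  have sets: "sets \<mu> = sets (restrict_space borel unit_I)"
    using assms(3) by (simp add: invariant_measures_def)
  have space: "space \<mu> = unit_I"
    using sets_eq_imp_space_eq[OF sets] by (simp add: space_restrict_space)
  have "f \<in> borel_measurable (restrict_space borel unit_I)"
    using holder_fun_continuous_on[OF assms(1,2)]
    by (rule borel_measurable_continuous_on_restrict)
  then have meas: "f \<in> borel_measurable \<mu>"
    using measurable_cong_sets[OF sets refl] by blast
  let ?B = "SUP x\<in>unit_I. \<bar>f x\<bar>"
  have bound: "\<bar>f x\<bar> \<le> ?B" if "x \<in> space \<mu>" for x
    using that space by (intro cSUP_upper holder_fun_bdd_values[OF assms(1,2)]) simp
  show int: "integrable \<mu> f"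
    using bound by (intro integrable_const_bound[OF _ meas, of ?B]) auto
  have "integral\<^sup>L \<mu> f \<le> ?B" "- ?B \<le> integral\<^sup>L \<mu> f"
    using bound by (intro integral_le_const integral_ge_const int AE_I2; fastforce)+
  then show "\<bar>integral\<^sup>L \<mu> f\<bar> \<le> ?B" by linarith
qed

lemma bdd_above_integrals:
  assumes "0 < \<alpha>" "holder_fun \<alpha> f"
  shows "bdd_above ((\<lambda>\<mu>. integral\<^sup>L \<mu> f) ` invariant_measures T)"
  using holder_fun_integrable(2)[OF assms] by (intro bdd_aboveI2) (rule abs_le_D1)

lemma orbit_measure_invariant:
  assumes "periodic_orbit gauss S"
  shows "orbit_measure S \<in> invariant_measures gauss"
proof -
  obtain p n where p: "p \<in> unit_I" "n > 0" "(gauss ^^ n) p = p"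
    and S: "S = {(gauss ^^ k) p | k. k < n}"
    using assms unfolding periodic_orbit_def by blast
  have fin: "finite S" and ne: "S \<noteq> {}" using p(2) by (auto simp: S)
  have "(gauss ^^ k) p \<in> unit_I" for k
    using p(1) gauss_in_unit_I by (cases k) (simp_all del: atLeastAtMost_iff)
  then have sub: "S \<subseteq> unit_I" using S by blast
  have "S \<subseteq> gauss ` S"
  proof
    fix x assume "x \<in> S"
    then obtain k where k: "k < n" "x = (gauss ^^ k) p" using S by blast
    show "x \<in> gauss ` S"
    proof (cases k)
      case 0
      then have "x = gauss ((gauss ^^ (n - 1)) p)"
        using k p by (metis Suc_diff_1 comp_apply funpow.simps(2) funpow_0)
      moreover have "(gauss ^^ (n - 1)) p \<in> S"
        using p(2) S by (auto intro!: exI[of _ "n - 1"])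
      ultimately show ?thesis by blast
    next
      case (Suc j)
      then have "x = gauss ((gauss ^^ j) p)" "(gauss ^^ j) p \<in> S"
        using k S by auto
      then show ?thesis by blast
    qed
  qed
  then have inj: "inj_on gauss S" and im: "gauss ` S = S"
    using fin finite_surj_inj surj_card_le[OF fin] card_seteq[of "gauss ` S" S] card_image_le[OF fin]
    by blast+
  let ?U = "uniform_count_measure S" and ?B = "restrict_space borel unit_I"
  have id: "(\<lambda>x. x) \<in> measurable ?U ?B"
    using sub by (auto simp: measurable_def space_uniform_count_measure sets_uniform_count_measure
        space_restrict_space)
  have g: "gauss \<in> measurable ?U ?U"
    using im by (auto simp: measurable_def space_uniform_count_measure sets_uniform_count_measure)
  have gB: "gauss \<in> measurable ?B ?B" by (rule gauss_measurable) simp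
  have U: "distr ?U ?U gauss = ?U"
  proof (rule measure_eqI)
    fix A assume "A \<in> sets (distr ?U ?U gauss)"
    then have A: "A \<subseteq> S" by (simp add: sets_uniform_count_measure)
    have "card (gauss -` A \<inter> S) = card (gauss ` (gauss -` A \<inter> S))"
      using inj by (intro card_image[symmetric]) (auto intro: inj_on_subset)
    also have "gauss ` (gauss -` A \<inter> S) = A \<inter> gauss ` S" by blast
    also have "\<dots> = A" using im A by auto
    finally show "emeasure (distr ?U ?U gauss) A = emeasure ?U A"
      using A fin g by (simp add: emeasure_distr emeasure_uniform_count_measure
          sets_uniform_count_measure space_uniform_count_measure)
  qed simp
  have "distr (orbit_measure S) (orbit_measure S) gauss = distr (distr ?U ?B (\<lambda>x. x)) ?B gauss"
    by (rule distr_cong) (simp_all add: orbit_measure_def)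
  also have "\<dots> = distr ?U ?B gauss"
    by (simp add: distr_distr[OF gB id] o_def)
  also have "\<dots> = distr (distr ?U ?U gauss) ?B (\<lambda>x. x)"
    by (simp add: distr_distr[OF id g] o_def)
  also have "\<dots> = orbit_measure S" by (simp add: U orbit_measure_def)
  finally have inv: "distr (orbit_measure S) (orbit_measure S) gauss = orbit_measure S" .
  have "prob_space (orbit_measure S)"
    unfolding orbit_measure_def
    by (intro prob_space.prob_space_distr prob_space_uniform_count_measure fin ne id)
  moreover have "sets (orbit_measure S) = sets ?B" by (simp add: orbit_measure_def)
  ultimately show ?thesis
    using inv gauss_measurable by (simp add: invariant_measures_def)
qed

end

theory Submission
  imports Defs
begin

text \<open>Let \<open>\<phi>\<close> be zero away from \<open>1\<close>, with a steep Hoelder peak of height \<open>2\<close> at \<open>1\<close>. The orbits of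
  period two with continued fraction digits \<open>1, n\<close> accumulate at \<open>{0, 1}\<close>, so the maximal
  integral is at least \<open>M = (\<phi> 0 + \<phi> 1) / 2\<close>. No periodic orbit attains \<open>M\<close>: it avoids \<open>1\<close>,
  which is not in the range of the Gauss map; a point \<open>x < 1\<close> close to \<open>1\<close>, paired with its image
  close to \<open>0\<close>, contributes less than \<open>2 M\<close>, the loss \<open>(1 - x) powr \<alpha>\<close> at the peak dominating the
  possible gain at the image; and every other point contributes less than \<open>M\<close>. These
  inequalities persist under small perturbations in the Hoelder norm.\<close>

section \<open>Powers with exponent at most one\<close>

text \<open>Each share t = \<open>c / (a + b)\<close> lies in [0, 1], where t \<le>
  \<open>t powr \<alpha>\<close> because \<alpha> \<le> 1. Scaling this by
  \<open>(a + b) powr \<alpha>\<close> for c = a and c = b and adding gives the claim.\<close>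

lemma powr_add_le:
  fixes a b :: real
  assumes "0 \<le> a" "0 \<le> b" "0 < \<alpha>" "\<alpha> \<le> 1"
  shows "(a + b) powr \<alpha> \<le> a powr \<alpha> + b powr \<alpha>"
proof (cases "a + b = 0")
  case False
  then have s: "a + b > 0" using assms by linarith
  have le: "c / (a + b) * (a + b) powr \<alpha> \<le> c powr \<alpha>" if "0 \<le> c" "c \<le> a + b" for c
  proof -
    have "c / (a + b) \<le> (c / (a + b)) powr \<alpha>"
      using powr_mono'[of \<alpha> 1 "c / (a + b)"] assms s that by simp
    then have "c / (a + b) * (a + b) powr \<alpha> \<le> (c / (a + b)) powr \<alpha> * (a + b) powr \<alpha>"
      by (rule mult_right_mono) simp
    also have "\<dots> = c powr \<alpha>"
      using s that by (simp add: powr_divide)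
    finally show ?thesis .
  qed
  have "(a + b) powr \<alpha> = a / (a + b) * (a + b) powr \<alpha> + b / (a + b) * (a + b) powr \<alpha>"
    using s by (simp flip: distrib_right add_divide_distrib)
  also have "\<dots> \<le> a powr \<alpha> + b powr \<alpha>"
    using assms by (intro add_mono le) auto
  finally show ?thesis .
qed (use assms in auto)

lemma abs_powr_diff_le:
  fixes a b :: real
  assumes "0 \<le> a" "0 \<le> b" "0 < \<alpha>" "\<alpha> \<le> 1"
  shows "\<bar>a powr \<alpha> - b powr \<alpha>\<bar> \<le> \<bar>a - b\<bar> powr \<alpha>"
proof -
  have "v powr \<alpha> - u powr \<alpha> \<le> \<bar>v - u\<bar> powr \<alpha> \<and> u powr \<alpha> \<le> v powr \<alpha>" if "0 \<le> u" "u \<le> v" for u v :: real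
    using powr_add_le[of u "v - u" \<alpha>] that assms by (auto intro: powr_mono2)
  from this[of a b] this[of b a] assms show ?thesis
    by (cases "a \<le> b") (auto simp: abs_minus_commute)
qed

section \<open>Periodic orbits of the Gauss map and averages along them\<close>

lemma gauss_less_1: "gauss x < 1"
  unfolding gauss_def by (auto; linarith)

lemma gauss_eq:
  assumes "1 / x = of_int k + y" "0 \<le> y" "y < 1" "x \<noteq> 0"
  shows "gauss x = y"
proof -
  have "\<lfloor>1 / x\<rfloor> = k" using assms by (intro floor_unique) auto
  then show ?thesis using assms by (simp add: gauss_def)
qed

lemma periodic_orbit_gauss:
  assumes "periodic_orbit gauss S"
  shows "finite S" "S \<noteq> {}" "S \<subseteq> unit_I" "gauss ` S = S"
proof -
  obtain p n where p: "p \<in> unit_I" "n > 0" "(gauss ^^ n) p = p"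
    and S: "S = {(gauss ^^ k) p | k. k < n}"
    using assms unfolding periodic_orbit_def by blast
  show fin: "finite S" and "S \<noteq> {}" using p(2) by (auto simp: S)
  have "(gauss ^^ k) p \<in> unit_I" for k
    using p(1) gauss_in_unit_I by (cases k) (simp_all del: atLeastAtMost_iff)
  then show "S \<subseteq> unit_I" using S by blast
  have "x \<in> gauss ` S" if "x \<in> S" for x
  proof -
    obtain k where k: "k < n" "x = (gauss ^^ k) p" using \<open>x \<in> S\<close> S by blast
    \<comment> \<open>The cyclic predecessor of k: the point p itself is reached from time n - 1,
      since the orbit closes up at time n.\<close>
    define j where "j = (if k = 0 then n - 1 else k - 1)"
    have "x = (gauss ^^ Suc j) p" "j < n" using k p by (auto simp: j_def simp del: funpow.simps)
    then show ?thesis using S by auto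
  qed
  then show "gauss ` S = S"
    using fin by (metis card_image_le card_seteq finite_imageI subsetI)
qed

lemma orbit_measure_integral:
  assumes "finite S" "S \<subseteq> unit_I" "continuous_on unit_I f"
  shows "integral\<^sup>L (orbit_measure S) f = sum f S / card S"
proof -
  have "(\<lambda>x. x) \<in> measurable (uniform_count_measure S) (restrict_space borel unit_I)"
    using assms(2) by (auto simp: measurable_def space_uniform_count_measure
        sets_uniform_count_measure space_restrict_space)
  moreover have "f \<in> borel_measurable (restrict_space borel unit_I)"
    using assms(3) by (rule borel_measurable_continuous_on_restrict)
  ultimately have "integral\<^sup>L (orbit_measure S) f = integral\<^sup>L (uniform_count_measure S) f"
    unfolding orbit_measure_def by (rule integral_distr)
  then show ?thesis using assms(1) by (simp add: integral_uniform_count_measure)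
qed

text \<open>A surjection of a finite set is a permutation, so each x in A can be charged together
  with its own partner \<open>T x\<close>, and these pairs are disjoint. All other points are below
  M individually.\<close>

lemma sum_less_by_pairing:
  fixes f :: "'a \<Rightarrow> real" and M :: real
  assumes S: "finite S" "S \<noteq> {}" "T ` S = S"
    and A: "A \<subseteq> S" "A \<inter> T ` A = {}"
    and pair: "\<And>x. x \<in> A \<Longrightarrow> f x + f (T x) < 2 * M"
    and single: "\<And>x. x \<in> S - A \<Longrightarrow> f x < M"
  shows "sum f S < card S * M"
proof -
  let ?g = "\<lambda>x. M - f x" and ?B = "A \<union> T ` A"
  have inj: "inj_on T A"
    using S A by (metis eq_card_imp_inj_on inj_on_subset)
  have B: "?B \<subseteq> S" using S A by blast
  have "sum ?g ?B = sum ?g A + sum ?g (T ` A)"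
    using A S finite_subset[OF A(1) S(1)] by (intro sum.union_disjoint) auto
  also have "\<dots> = (\<Sum>x\<in>A. ?g x + ?g (T x))"
    by (simp only: sum.reindex[OF inj] sum.distrib o_def)
  finally have *: "sum ?g S = (\<Sum>x\<in>A. ?g x + ?g (T x)) + sum ?g (S - ?B)"
    using sum.subset_diff[OF B S(1), of ?g] by linarith
  have pos: "0 < ?g x + ?g (T x)" if "x \<in> A" for x using pair[OF that] by linarith
  have "0 \<le> sum ?g (S - ?B)"
    using single by (intro sum_nonneg) (simp add: less_imp_le)
  \<comment> \<open>Strictness comes from the pairs if there are any, and otherwise from the single
    points, which then make up the nonempty set S.\<close>
  moreover have "0 < (\<Sum>x\<in>A. ?g x + ?g (T x))" if "A \<noteq> {}"
    using that pos A S by (intro sum_pos) (auto intro: finite_subset)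
  moreover have "0 < sum ?g (S - ?B)" if "A = {}"
    using that single S by (intro sum_pos) auto
  ultimately have "0 < sum ?g S"
    unfolding * by (cases "A = {}") auto
  then show ?thesis by (simp add: sum_subtractf)
qed

section \<open>Lower bound for the maximal integral\<close>

text \<open>The number y is the positive root of y (1 + y) = 1 / n. Hence 1 / y = n (1 + y) = n + 1
  / (1 + y), which makes the digits of y alternate between n and 1.\<close>

lemma gauss_period_two:
  assumes "n > 0"
  defines "y \<equiv> (sqrt (1 + 4 / real n) - 1) / 2"
  shows "0 < y" "y < 1" "gauss (1 / (1 + y)) = y" "gauss y = 1 / (1 + y)" "y * (1 + y) = 1 / n"
proof -
  define s where "s = sqrt (1 + 4 / real n)"
  have s2: "s\<^sup>2 = 1 + 4 / real n" by (simp add: s_def)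
  have "s > 1" using assms(1) by (simp add: s_def)
  moreover have "s < 3"
  proof -
    have "4 / real n \<le> 4" using assms(1) by (simp add: divide_le_eq)
    then show ?thesis unfolding s_def by (intro real_less_lsqrt) auto
  qed
  ultimately show y: "0 < y" "y < 1" by (simp_all add: y_def s_def)
  show eq: "y * (1 + y) = 1 / n"
    using s2 by (simp add: y_def s_def[symmetric] field_simps power2_eq_square)
  then have "1 / y = n * (1 + y)"
    using y assms(1) by (simp add: field_simps)
  also have "\<dots> = n + 1 / (1 + y)"
    using eq y assms(1) by (simp add: field_simps)
  finally show "gauss y = 1 / (1 + y)"
    using y by (intro gauss_eq[of _ "int n"]) auto
  show "gauss (1 / (1 + y)) = y"
    using y by (intro gauss_eq[of _ 1]) auto
qed

lemma max_integral_ge: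
  assumes "0 < \<alpha>" "holder_fun \<alpha> f"
  shows "(f 0 + f 1) / 2 \<le> max_integral gauss f"
proof -
  define y where "y n = (sqrt (1 + 4 / real n) - 1) / 2" for n
  define x where "x n = 1 / (1 + y n)" for n
  note cont = holder_fun_continuous_on[OF assms]
  have y0: "y \<longlonglongrightarrow> 0"
  proof -
    have "y \<longlonglongrightarrow> (sqrt (1 + 0) - 1) / 2"
      unfolding y_def by (intro tendsto_intros lim_const_over_n) simp
    then show ?thesis by simp
  qed
  have x1: "x \<longlonglongrightarrow> 1"
    using tendsto_divide[OF tendsto_const tendsto_add[OF tendsto_const y0], of 1 1]
    unfolding x_def by simp
  have two: "0 < y n" "y n < 1" "gauss (x n) = y n" "gauss (y n) = x n" "y n * (1 + y n) = 1 / n"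
    if "n > 0" for n
    using gauss_period_two[OF that] by (simp_all add: y_def x_def)
  have in_I: "y n \<in> unit_I" "x n \<in> unit_I" if "n > 0" for n
    using two[OF that] by (auto simp: x_def)
  have "(\<lambda>n. (f (y n) + f (x n)) / 2) \<longlonglongrightarrow> (f 0 + f 1) / 2"
    using in_I
    by (intro tendsto_intros continuous_on_tendsto_compose[OF cont y0]
        continuous_on_tendsto_compose[OF cont x1] eventually_sequentiallyI[of 1]) auto
  \<comment> \<open>For n = 1 the two points coincide in a fixed point, and the orbit would have
    only one element.\<close>
  moreover have "(f (y n) + f (x n)) / 2 \<le> max_integral gauss f" if "n > 1" for n
  proof -
    have n: "n > 0" using that by simp
    let ?S = "{y n, x n}"
    have ne: "y n \<noteq> x n"
    proof
      assume "y n = x n"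
      then have "y n * (1 + y n) = 1"
        using two(1)[OF n] by (simp add: x_def field_simps)
      then show False using two(5)[OF n] that by simp
    qed
    have "{(gauss ^^ k) (y n) | k. k < 2} = (\<lambda>k. (gauss ^^ k) (y n)) ` {..<2}" by blast
    also have "\<dots> = ?S"
      using two[OF n] by (auto simp: lessThan_nat_numeral lessThan_Suc)
    finally have "?S = {(gauss ^^ k) (y n) | k. k < 2}" by (rule sym)
    then have S: "periodic_orbit gauss ?S"
      unfolding periodic_orbit_def using two[OF n] in_I[OF n]
      by (intro bexI[of _ "y n"] exI[of _ 2]) (auto simp: numeral_2_eq_2)
    have "(f (y n) + f (x n)) / 2 = integral\<^sup>L (orbit_measure ?S) f"
      using ne in_I[OF n] by (simp add: orbit_measure_integral cont)
    also have "\<dots> \<le> max_integral gauss f"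
      unfolding max_integral_def
      by (intro cSUP_upper orbit_measure_invariant S bdd_above_integrals[OF assms])
    finally show ?thesis .
  qed
  ultimately show ?thesis
    by (intro LIMSEQ_le_const2) (auto intro!: exI[of _ 2])
qed

section \<open>The peak and its perturbations\<close>

lemma holder_norm_bounds:
  assumes "0 < \<alpha>" "holder_fun \<alpha> f" "holder_norm \<alpha> f < r" "x \<in> unit_I" "y \<in> unit_I"
  shows "\<bar>f x\<bar> \<le> r" "\<bar>f x - f y\<bar> \<le> r * \<bar>x - y\<bar> powr \<alpha>"
proof -
  have up: "\<bar>f z\<bar> \<le> (SUP z\<in>unit_I. \<bar>f z\<bar>)" if "z \<in> unit_I" for z
    using that by (intro cSUP_upper holder_fun_bdd_values[OF assms(1,2)])
  show "\<bar>f x\<bar> \<le> r"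
    using up[OF assms(4)] holder_seminorm_nonneg[OF assms(2)] assms(3)
    by (simp add: holder_norm_def)
  have "holder_seminorm \<alpha> f \<le> r"
    using up[OF assms(4)] assms(3) by (simp add: holder_norm_def)
  then have "\<bar>f x - f y\<bar> / \<bar>x - y\<bar> powr \<alpha> \<le> r" if "x \<noteq> y"
    using holder_seminorm_upper[OF assms(2,4,5) that] by linarith
  then show "\<bar>f x - f y\<bar> \<le> r * \<bar>x - y\<bar> powr \<alpha>"
    by (cases "x = y") (auto simp: divide_le_eq)
qed

text \<open>The slope \<open>8\<close> confines the peak to \<open>{3 / 4<..1}\<close>, which the Gauss map sends off the peak.\<close>

definition peak :: "real \<Rightarrow> real \<Rightarrow> real" where
  "peak \<alpha> x = (if x \<in> unit_I then max 0 (2 - 8 * (1 - x) powr \<alpha>) else undefined)"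

lemma peak_in_holder_space:
  assumes "0 < \<alpha>" "\<alpha> \<le> 1"
  shows "peak \<alpha> \<in> holder_space \<alpha>"
proof -
  have "\<bar>peak \<alpha> x - peak \<alpha> y\<bar> \<le> 8 * \<bar>x - y\<bar> powr \<alpha>" if "x \<in> unit_I" "y \<in> unit_I" for x y
    using abs_powr_diff_le[of "1 - x" "1 - y" \<alpha>] that assms
    by (auto simp: peak_def max_def abs_minus_commute)
  then have "holder_fun \<alpha> (peak \<alpha>)" unfolding holder_fun_def by blast
  then show ?thesis by (auto simp: holder_space_def extensional_def peak_def)
qed

text \<open>Since \<alpha> \<le> 1, \<open>(1 - x) powr \<alpha>\<close> is at least 1 - x \<ge> 1 /
  4, and eight times that is at least the height 2.\<close>

lemma peak_eq_0:
  assumes "0 < \<alpha>" "\<alpha> \<le> 1" "0 \<le> x" "x \<le> 3 / 4"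
  shows "peak \<alpha> x = 0"
  using powr_mono'[of \<alpha> 1 "1 - x"] assms by (simp add: peak_def)

text \<open>With coefficient 2 the bound stays nonnegative on the whole interval, so it also covers
  the truncated part.\<close>

lemma peak_le:
  assumes "0 < \<alpha>" "0 \<le> x" "x \<le> 1"
  shows "peak \<alpha> x \<le> 2 - 2 * (1 - x) powr \<alpha>"
  using powr_le1[of \<alpha> "1 - x"] assms by (simp add: peak_def)

lemma not_periodic_optimization:
  assumes \<alpha>: "0 < \<alpha>" "\<alpha> \<le> 1" and \<psi>: "\<psi> \<in> holder_space \<alpha>"
    and near: "holder_norm \<alpha> (\<lambda>x. peak \<alpha> x - \<psi> x) < 1 / 4"
  shows "\<not> periodic_optimization_property gauss \<psi>"
proof
  have h\<psi>: "holder_fun \<alpha> \<psi>" using \<psi> by (simp add: holder_space_def)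
  have "holder_fun \<alpha> (\<lambda>x. peak \<alpha> x - \<psi> x)"
    using peak_in_holder_space[OF \<alpha>] h\<psi> by (intro holder_fun_diff) (auto simp: holder_space_def)
  note bounds = holder_norm_bounds[OF \<alpha>(1) this near]
  define M where "M = (\<psi> 0 + \<psi> 1) / 2"
  have peak01: "peak \<alpha> 0 = 0" "peak \<alpha> 1 = 2" using \<alpha> by (auto simp: peak_def)
  \<comment> \<open>The perturbation moves each value by at most 1 / 4, so M is at least (-1 / 4 + 7
    / 4) / 2.\<close>
  have M: "M \<ge> 3 / 4"
  proof -
    have "- (1 / 4) \<le> \<psi> 0" "7 / 4 \<le> \<psi> 1"
      using bounds(1)[of 0 0] bounds(1)[of 1 1] peak01 unfolding abs_le_iff by auto
    then show ?thesis by (simp add: M_def)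
  qed
  \<comment> \<open>Put t = \<open>(1 - x) powr \<alpha>\<close>. Relative to
    \<open>\<psi> 1\<close>, the value at x changes by at most (1 / 4 - 2) t. Relative to
    \<open>\<psi> 0\<close>, the image gains at most (1 / 4) 2 t. The total is at most -(5 / 4) t <
    0.\<close>
  have pair: "\<psi> x + \<psi> (gauss x) < 2 * M \<and> gauss x < 3 / 4" if x: "3 / 4 \<le> x" "x < 1" for x
  proof -
    have y: "gauss x = 1 / x - 1" using x by (intro gauss_eq[of _ 1]) (auto simp: field_simps)
    have y0: "0 \<le> gauss x" "gauss x \<le> 3 / 4" "gauss x < 3 / 4"
      unfolding y using x by (auto simp: field_simps)
    have "gauss x \<le> 2 * (1 - x)"
    proof -
      have "(1 - x) * 1 \<le> (1 - x) * (2 * x)" using x by (intro mult_left_mono) auto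
      then show ?thesis unfolding y using x by (simp add: field_simps)
    qed
    then have "gauss x powr \<alpha> \<le> (2 * (1 - x)) powr \<alpha>"
      using y0 \<alpha> by (intro powr_mono2) auto
    also have "\<dots> = 2 powr \<alpha> * (1 - x) powr \<alpha>" by (rule powr_mult)
    also have "\<dots> \<le> 2 * (1 - x) powr \<alpha>"
      using powr_mono[of \<alpha> 1 2] \<alpha> by (intro mult_right_mono) auto
    finally have "gauss x powr \<alpha> \<le> 2 * (1 - x) powr \<alpha>" .
    moreover have "\<psi> (gauss x) - \<psi> 0 \<le> 1 / 4 * gauss x powr \<alpha>"
      using bounds(2)[of "gauss x" 0] y0 peak_eq_0[OF \<alpha> y0(1,2)] peak01
      unfolding abs_le_iff by simp
    moreover have "\<psi> x - \<psi> 1 \<le> 1 / 4 * (1 - x) powr \<alpha> - 2 * (1 - x) powr \<alpha>"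
      using bounds(2)[of x 1] x peak_le[OF \<alpha>(1), of x] peak01
      unfolding abs_le_iff by simp
    moreover have "(1 - x) powr \<alpha> > 0" using x by simp
    moreover have "2 * M = \<psi> 0 + \<psi> 1" by (simp add: M_def)
    ultimately show ?thesis using y0(3) by linarith
  qed
  assume "periodic_optimization_property gauss \<psi>"
  then obtain S where S: "periodic_orbit gauss S"
    and max: "maximizing_measure gauss \<psi> (orbit_measure S)"
    unfolding periodic_optimization_property_def by blast
  note S_props = periodic_orbit_gauss[OF S]
  have lt1: "x < 1" if "x \<in> S" for x using that S_props(4) gauss_less_1 by (metis imageE)
  let ?A = "{x \<in> S. 3 / 4 \<le> x}"
  have "sum \<psi> S < card S * M"
  proof (rule sum_less_by_pairing[OF S_props(1,2,4), of ?A])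
    show "?A \<inter> gauss ` ?A = {}" using pair lt1 by fastforce
    \<comment> \<open>Off the peak, \<psi> is at most the perturbation size 1 / 4, well below
      M.\<close>
    show "\<psi> x < M" if "x \<in> S - ?A" for x
      using that S_props(3) bounds(1)[of x x] peak_eq_0[OF \<alpha>, of x] M by (auto simp: subset_iff)
  qed (use pair lt1 in auto)
  then have "integral\<^sup>L (orbit_measure S) \<psi> < M"
    using S_props card_gt_0_iff[of S]
    by (simp add: orbit_measure_integral holder_fun_continuous_on[OF \<alpha>(1) h\<psi>] field_simps)
  with max max_integral_ge[OF \<alpha>(1) h\<psi>] show False
    by (simp add: maximizing_measure_def M_def)
qed

theorem theorem3:
  fixes \<alpha> :: real
  assumes "0 < \<alpha>" and "\<alpha> \<le> 1"
  shows "\<exists>U. openin (holder_topology \<alpha>) U \<and> U \<noteq> {} \<and>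
             (\<forall>\<phi>\<in>U. \<not> periodic_optimization_property gauss \<phi>)"
proof -
  interpret Metric_space "holder_space \<alpha>" "holder_dist \<alpha>"
    using assms(1) by (rule Metric_space_holder)
  note peak = peak_in_holder_space[OF assms]
  \<comment> \<open>Points of the ball lie in the space, so \<open>holder_dist\<close> is the norm
    of the difference here and not its default value 0.\<close>
  have "\<not> periodic_optimization_property gauss \<psi>" if "\<psi> \<in> mball (peak \<alpha>) (1 / 4)" for \<psi>
    using that assms by (intro not_periodic_optimization) (auto simp: mball_def holder_dist_def)
  moreover have "peak \<alpha> \<in> mball (peak \<alpha>) (1 / 4)" using peak by simp
  ultimately show ?thesis
    unfolding holder_topology_def using openin_mball by blast
qed

end
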